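(* Given $N\in\mathbb{Z}$, $k\in\mathbb{N}$ and $j\in\{0,1,\ldots,k-1\}$, for $\nu$-a.e. $x\in(0,1)$, the probability that the number $j$ appears in the sequence $\Big\{\sum_{l=0}^{nN}\binom{nN}{l}x_{l+1}\ (\bmod\ k)\Big\}_{n=1}^{\infty}$ is $1/k$, where $0.x_1x_2\ldots$ is the $k$-adic development of $x$; that is, $$\lim_{p\to\infty}\frac1p\,\#\Big\{1\le n\le p:\ \sum_{l=0}^{nN}\binom{nN}{l}x_{l+1}\equiv j\pmod k\Big\}=\frac1k .$$
   Context: $\nu$ is the Lebesgue measure on $[0,1]$. The $k$-adic development $0.x_1x_2\ldots$ of $x$ is its base-$k$ expansion $x=\sum_{i\ge1}x_i k^{-i}$ with digits $x_i\in\{0,1,\ldots,k-1\}$. $\binom{nN}{l}$ is the combinatorial number (binomial coefficient), and $\#$ denotes the number of elements of a finite set.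
   Formalization: N is taken to be a positive integer instead of any integer: for N = 0 the sequence is constantly x_1, and for N < 0 the sum over l from 0 to nN is empty, so the claimed frequency 1/k fails for every k ≥ 2. *)

theory Defs
  imports "HOL-Analysis.Analysis" "HOL-Number_Theory.Cong"
begin

text \<open>
  Digits are indexed from 1, as in \<open>x = 0.x\<^sub>1x\<^sub>2\<dots>\<close>; the value \<open>d 0\<close> is irrelevant.
  The two developments of a \<open>k\<close>-adic rational both qualify.
\<close>

definition kadic_development :: "nat \<Rightarrow> real \<Rightarrow> (nat \<Rightarrow> nat) \<Rightarrow> bool" where
  "kadic_development k x d \<longleftrightarrow>
     (\<forall>i\<ge>1. d i < k) \<and> (\<lambda>i. real (d (Suc i)) / real k ^ Suc i) sums x"

lemma kadic_development_floor:
  assumes "k \<ge> 2" "0 \<le> x" "x < 1"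
  shows "kadic_development k x (\<lambda>i. nat \<lfloor>x * real k ^ i\<rfloor> mod k)"
proof -
  let ?d = "\<lambda>i. nat \<lfloor>x * real k ^ i\<rfloor> mod k"
  have k0: "real k > 0" using assms(1) by simp
  have div: "nat \<lfloor>x * real k ^ Suc n\<rfloor> div k = nat \<lfloor>x * real k ^ n\<rfloor>" for n
  proof -
    have "\<lfloor>x * real k ^ Suc n\<rfloor> div int k = \<lfloor>x * real k ^ Suc n / real k\<rfloor>"
      using floor_divide_real_eq_div[of "int k" "x * real k ^ Suc n"] by simp
    also have "x * real k ^ Suc n / real k = x * real k ^ n" using k0 by simp
    finally show ?thesis
      by (metis div_eq_dividend_iff nat_div_distrib' nat_int of_nat_0_le_iff)
  qed
  have partial: "(\<Sum>i<n. real (?d (Suc i)) / real k ^ Suc i) = real (nat \<lfloor>x * real k ^ n\<rfloor>) / real k ^ n" for n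
  proof (induction n)
    case 0
    have "\<lfloor>x\<rfloor> = 0" using assms by linarith
    then show ?case by simp
  next
    case (Suc n)
    have "nat \<lfloor>x * real k ^ Suc n\<rfloor> = k * nat \<lfloor>x * real k ^ n\<rfloor> + ?d (Suc n)"
      using div[of n] by (metis mult_div_mod_eq)
    then have "real (nat \<lfloor>x * real k ^ Suc n\<rfloor>) = real k * real (nat \<lfloor>x * real k ^ n\<rfloor>) + real (?d (Suc n))"
      by (metis of_nat_add of_nat_mult)
    then have "real (nat \<lfloor>x * real k ^ Suc n\<rfloor>) / real k ^ Suc n
        = real (nat \<lfloor>x * real k ^ n\<rfloor>) / real k ^ n + real (?d (Suc n)) / real k ^ Suc n"
      using k0 by (simp add: add_divide_distrib)
    then show ?case using Suc by simp
  qed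
  have "(\<lambda>n. real (nat \<lfloor>x * real k ^ n\<rfloor>) / real k ^ n) \<longlonglongrightarrow> x"
  proof (rule tendsto_sandwich[where f = "\<lambda>n. x - (1 / real k) ^ n" and h = "\<lambda>n. x"])
    show "\<forall>\<^sub>F n in sequentially. x - (1 / real k) ^ n \<le> real (nat \<lfloor>x * real k ^ n\<rfloor>) / real k ^ n"
    proof (intro always_eventually allI)
      fix n
      have "x * real k ^ n - 1 \<le> real (nat \<lfloor>x * real k ^ n\<rfloor>)" by linarith
      then have "(x * real k ^ n - 1) / real k ^ n \<le> real (nat \<lfloor>x * real k ^ n\<rfloor>) / real k ^ n"
        by (intro divide_right_mono) auto
      then show "x - (1 / real k) ^ n \<le> real (nat \<lfloor>x * real k ^ n\<rfloor>) / real k ^ n"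
        using k0 by (simp add: diff_divide_distrib power_divide)
    qed
    show "\<forall>\<^sub>F n in sequentially. real (nat \<lfloor>x * real k ^ n\<rfloor>) / real k ^ n \<le> x"
      using k0 assms(2) by (intro always_eventually allI) (simp add: pos_divide_le_eq)
    have "(\<lambda>n. (1 / real k) ^ n) \<longlonglongrightarrow> 0"
      using assms(1) by (intro LIMSEQ_realpow_zero) auto
    then show "(\<lambda>n. x - (1 / real k) ^ n) \<longlonglongrightarrow> x"
      using tendsto_diff[OF tendsto_const[of x]] by fastforce
  qed auto
  then have "(\<lambda>i. real (?d (Suc i)) / real k ^ Suc i) sums x"
    unfolding sums_def partial .
  then show ?thesis
    unfolding kadic_development_def using assms(1) by simp
qed

end

theory Submission
  imports Defs
begin

text \<open>
  Write \<open>S\<^sub>n\<close> for the binomial sum with upper index \<open>nN\<close>. Its last coefficient is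
  \<open>(nN choose nN) = 1\<close>, so modulo \<open>k\<close> the sum \<open>S\<^sub>n\<close> is a function of the first \<open>nN\<close> digits plus
  the digit number \<open>nN + 1\<close>. Under Lebesgue measure this digit is uniform and independent of
  the digits before it; hence so is \<open>S\<^sub>n\<close> modulo \<open>k\<close>, whatever the other coefficients are. Since
  \<open>N \<ge> 1\<close>, every earlier \<open>S\<^sub>m\<close> depends only on the first \<open>nN\<close> digits. The
  events \<open>S\<^sub>n \<equiv> j\<close> are therefore pairwise independent, each of measure \<open>1/k\<close>
  (\<open>measure_last_digit_constraint\<close>).

  Pairwise independence is enough for a strong law: the centred indicators are bounded and
  pairwise orthogonal, so their partial sums have second moment of at most linear growth. This
  gives convergence of the averages along the squares by summability, and boundedness bridges the gaps
  between squares (\<open>orthogonal_averages_tendsto_zero_AE\<close>).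

  The digits used in this argument are those read off from \<open>\<lfloor>x k\<^sup>i\<rfloor>\<close>. They are the digits of
  every development of \<open>x\<close> unless \<open>x\<close> is a \<open>k\<close>-adic rational, and those form a countable set
  (\<open>kadic_development_digit_unique\<close>, \<open>AE_not_kadic_rational\<close>).
\<close>

section \<open>A strong law for bounded orthogonal functions\<close>

text \<open>
  Between consecutive squares \<open>m\<^sup>2\<close> and \<open>(m + 1)\<^sup>2\<close> there are only \<open>2m\<close> steps of size at most
  one, which is negligible against \<open>m\<^sup>2\<close>.
\<close>

lemma averages_tendsto_zero_from_squares:
  fixes s :: "nat \<Rightarrow> real"
  assumes step: "\<And>n. \<bar>s (Suc n) - s n\<bar> \<le> 1"
    and squares: "(\<lambda>m. s (m\<^sup>2) / real (m\<^sup>2)) \<longlonglongrightarrow> 0"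
  shows "(\<lambda>p. s p / real p) \<longlonglongrightarrow> 0"
proof -
  have lip: "\<bar>s (a + i) - s a\<bar> \<le> real i" for a i
  proof (induction i)
    case (Suc i)
    then show ?case using step[of "a + i"] by simp
  qed simp
  \<comment> \<open>The largest square up to \<open>p\<close> is the square of \<open>r p\<close>.\<close>
  define r where "r p = nat \<lfloor>sqrt (real p)\<rfloor>" for p
  have r_le: "real (r p) \<le> sqrt (real p)" for p
    unfolding r_def by simp
  have r_gt: "sqrt (real p) < real (r p) + 1" for p
    unfolding r_def by linarith
  have r_lim: "filterlim r at_top sequentially"
    unfolding r_def
    by (intro filterlim_compose[OF filterlim_nat_sequentially]
        filterlim_compose[OF filterlim_floor_sequentially]
        filterlim_compose[OF sqrt_at_top] filterlim_real_sequentially)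
  have "(\<lambda>m. \<bar>s (m\<^sup>2) / real (m\<^sup>2)\<bar> + 2 * (1 / real m)) \<longlonglongrightarrow> \<bar>0\<bar> + 2 * 0"
    by (intro tendsto_intros squares lim_1_over_n)
  then have bound_lim: "(\<lambda>p. \<bar>s ((r p)\<^sup>2) / real ((r p)\<^sup>2)\<bar> + 2 * (1 / real (r p))) \<longlonglongrightarrow> 0"
    using filterlim_compose[OF _ r_lim] by fastforce
  have bound: "\<bar>s p / real p\<bar> \<le> \<bar>s ((r p)\<^sup>2) / real ((r p)\<^sup>2)\<bar> + 2 * (1 / real (r p))"
    if "p \<ge> 1" for p
  proof -
    have "1 \<le> sqrt (real p)" using that by simp
    then have r1: "r p \<ge> 1" using r_gt[of p] by linarith
    have "(real (r p))\<^sup>2 \<le> (sqrt (real p))\<^sup>2" by (intro power_mono r_le) simp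
    then have le: "(r p)\<^sup>2 \<le> p" by (simp flip: of_nat_power)
    have "(sqrt (real p))\<^sup>2 < (real (r p) + 1)\<^sup>2" by (intro power_strict_mono r_gt) auto
    then have "real p < real ((r p + 1)\<^sup>2)" by (simp add: add.commute)
    then have "p < (r p + 1)\<^sup>2" by (simp only: of_nat_less_iff)
    then have gap: "p - (r p)\<^sup>2 \<le> 2 * r p" by (simp add: power2_eq_square)
    have "\<bar>s p - s ((r p)\<^sup>2)\<bar> \<le> real (p - (r p)\<^sup>2)"
      using lip[of "(r p)\<^sup>2" "p - (r p)\<^sup>2"] le by simp
    also have "\<dots> \<le> real (2 * r p)" using gap by (simp only: of_nat_le_iff)
    finally have "\<bar>s p\<bar> \<le> \<bar>s ((r p)\<^sup>2)\<bar> + 2 * real (r p)" by simp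
    then have "\<bar>s p\<bar> / real p \<le> (\<bar>s ((r p)\<^sup>2)\<bar> + 2 * real (r p)) / real ((r p)\<^sup>2)"
      using le r1 by (intro frac_le) (auto simp flip: of_nat_power)
    also have "\<dots> = \<bar>s ((r p)\<^sup>2) / real ((r p)\<^sup>2)\<bar> + 2 * (1 / real (r p))"
      using r1 by (simp add: add_divide_distrib power2_eq_square)
    finally show ?thesis using that by simp
  qed
  show ?thesis
    by (rule Lim_null_comparison[OF _ bound_lim])
      (use bound in \<open>auto intro!: eventually_sequentiallyI[of 1]\<close>)
qed

text \<open>
  By orthogonality the sum of \<open>p\<close> of the functions has second moment at most \<open>p\<close>, so its average
  has second moment at most \<open>1/p\<close>. That is not summable over \<open>p\<close>, but it is along \<open>p = m\<^sup>2\<close>.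
  There the series of squared averages has finite integral; so it converges almost everywhere,
  and its terms tend to zero.
\<close>

lemma orthogonal_averages_tendsto_zero_AE:
  fixes f :: "nat \<Rightarrow> 'a \<Rightarrow> real"
  assumes "finite_measure M" "measure M (space M) \<le> 1"
    and meas[measurable]: "\<And>n. f n \<in> borel_measurable M"
    and bounded: "\<And>n x. \<bar>f n x\<bar> \<le> 1"
    and orth: "\<And>m n. m < n \<Longrightarrow> (\<integral>x. f m x * f n x \<partial>M) = 0"
  shows "AE x in M. (\<lambda>p. (\<Sum>n<p. f n x) / real p) \<longlonglongrightarrow> 0"
proof -
  interpret finite_measure M by fact
  have int: "integrable M (\<lambda>x. f m x * f n x)" for m n
  proof (rule integrable_const_bound[where B = 1])
    show "AE x in M. norm (f m x * f n x) \<le> 1"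
      using mult_mono[OF bounded bounded] by (simp add: abs_mult)
  qed simp
  have diag: "(\<integral>x. f n x * f n x \<partial>M) \<le> 1" for n
  proof -
    have "f n x * f n x \<le> 1" for x
      using bounded[of n x] by (metis abs_square_le_1 power2_eq_square)
    then have "(\<integral>x. f n x * f n x \<partial>M) \<le> (\<integral>x. 1 \<partial>M)"
      by (intro integral_mono int) auto
    then show ?thesis using assms(2) by simp
  qed
  have orth': "(\<integral>x. f m x * f n x \<partial>M) = 0" if "m \<noteq> n" for m n
    using orth[of m n] orth[of n m] that by (cases "m < n") (auto simp: mult.commute)
  have sq_eq: "(\<Sum>n<p. f n x)\<^sup>2 = (\<Sum>m<p. \<Sum>n<p. f m x * f n x)" for p x
    by (simp add: power2_eq_square sum_product)
  have second_moment: "(\<integral>x. (\<Sum>n<p. f n x)\<^sup>2 \<partial>M) \<le> real p" for p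
  proof -
    have "(\<integral>x. (\<Sum>n<p. f n x)\<^sup>2 \<partial>M) = (\<Sum>m<p. \<Sum>n<p. (\<integral>x. f m x * f n x \<partial>M))"
      unfolding sq_eq by (simp add: int)
    also have "\<dots> = (\<Sum>m<p. \<Sum>n<p. if n = m then (\<integral>x. f m x * f m x \<partial>M) else 0)"
      by (intro sum.cong refl) (auto simp: orth')
    also have "\<dots> = (\<Sum>m<p. (\<integral>x. f m x * f m x \<partial>M))"
      by (simp add: sum.delta)
    also have "\<dots> \<le> (\<Sum>m<p. 1)" by (intro sum_mono diag)
    finally show ?thesis by simp
  qed
  \<comment> \<open>At \<open>m = 0\<close> the average is \<open>0 / 0 = 0\<close> and the bound \<open>1 / m\<^sup>2\<close> is also zero.\<close>
  define g where "g m x = ((\<Sum>n<m\<^sup>2. f n x) / real (m\<^sup>2))\<^sup>2" for m x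
  have g_meas[measurable]: "g m \<in> borel_measurable M" for m
    unfolding g_def by measurable
  have g_int: "integrable M (g m)" for m
    unfolding g_def power_divide sq_eq
    by (intro integrable_divide Bochner_Integration.integrable_sum int)
  have g_bound: "(\<integral>x. g m x \<partial>M) \<le> 1 / real m ^ 2" for m
  proof -
    have "(\<integral>x. g m x \<partial>M) = (\<integral>x. (\<Sum>n<m\<^sup>2. f n x)\<^sup>2 \<partial>M) / (real (m\<^sup>2))\<^sup>2"
      unfolding g_def power_divide by simp
    also have "\<dots> \<le> real (m\<^sup>2) / (real (m\<^sup>2))\<^sup>2"
      by (intro divide_right_mono second_moment) simp
    also have "\<dots> = 1 / real m ^ 2" by (simp add: power2_eq_square)
    finally show ?thesis .
  qed
  have g_nonneg: "g m x \<ge> 0" for m x by (simp add: g_def)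
  have "(\<integral>\<^sup>+x. (\<Sum>m. ennreal (g m x)) \<partial>M) = (\<Sum>m. \<integral>\<^sup>+x. ennreal (g m x) \<partial>M)"
    by (intro nn_integral_suminf) simp
  also have "\<dots> = (\<Sum>m. ennreal (\<integral>x. g m x \<partial>M))"
    by (intro suminf_cong nn_integral_eq_integral g_int) (simp add: g_nonneg)
  also have "\<dots> \<noteq> top"
  proof -
    have "summable (\<lambda>m. \<integral>x. g m x \<partial>M)"
    proof (rule summable_comparison_test)
      show "summable (\<lambda>m. 1 / real m ^ 2)"
        using inverse_power_summable[of 2, where 'a = real] by (simp add: divide_inverse)
      show "\<exists>N. \<forall>n\<ge>N. norm (\<integral>x. g n x \<partial>M) \<le> 1 / real n ^ 2"
        using g_bound g_nonneg by (auto simp: abs_of_nonneg)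
    qed
    then show ?thesis
      by (subst suminf_ennreal2) (auto simp: g_nonneg)
  qed
  finally have "AE x in M. (\<Sum>m. ennreal (g m x)) \<noteq> top"
    unfolding infinity_ennreal_def[symmetric] by (intro nn_integral_noteq_infinite) auto
  then show ?thesis
  proof (eventually_elim)
    case (elim x)
    then have "summable (\<lambda>m. g m x)"
      by (intro summable_suminf_not_top g_nonneg) simp
    then have "(\<lambda>m. sqrt (g m x)) \<longlonglongrightarrow> sqrt 0"
      by (intro tendsto_real_sqrt summable_LIMSEQ_zero)
    then have "(\<lambda>m. (\<Sum>n<m\<^sup>2. f n x) / real (m\<^sup>2)) \<longlonglongrightarrow> 0"
      unfolding g_def real_sqrt_abs by (simp only: tendsto_rabs_zero_iff real_sqrt_zero)
    then show ?case
      by (intro averages_tendsto_zero_from_squares) (auto simp: bounded)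
  qed
qed

section \<open>Digits as independent uniform variables\<close>

text \<open>
  The first \<open>i\<close> digits of \<open>x\<close> are encoded as one number in base \<open>k\<close>, with the \<open>i\<close>-th digit as its
  units. An event about finitely many digits then becomes a predicate on \<open>{..<k ^ i}\<close>, and its
  measure becomes a cardinality.
\<close>

definition digit_prefix :: "nat \<Rightarrow> nat \<Rightarrow> real \<Rightarrow> nat" where
  "digit_prefix k i x = nat \<lfloor>x * real k ^ i\<rfloor>"

lemma digit_prefix_measurable [measurable]:
  "digit_prefix k i \<in> measurable lborel (count_space UNIV)"
  unfolding digit_prefix_def by measurable

lemma digit_prefix_Suc_div:
  assumes "k > 0"
  shows "digit_prefix k (Suc n) x div k = digit_prefix k n x"
proof -
  have "\<lfloor>x * real k ^ Suc n\<rfloor> div int k = \<lfloor>x * real k ^ Suc n / real k\<rfloor>"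
    using floor_divide_real_eq_div[of "int k" "x * real k ^ Suc n"] by simp
  also have "x * real k ^ Suc n / real k = x * real k ^ n" using assms by simp
  finally show ?thesis
    unfolding digit_prefix_def
    by (metis div_eq_dividend_iff nat_div_distrib' nat_int of_nat_0_le_iff)
qed

lemma digit_prefix_add_div:
  assumes "k > 0"
  shows "digit_prefix k (n + i) x div k ^ i = digit_prefix k n x"
proof (induction i)
  case (Suc i)
  have "digit_prefix k (n + Suc i) x div k ^ Suc i
      = digit_prefix k (Suc (n + i)) x div k div k ^ i"
    by (simp add: div_mult2_eq)
  then show ?case using Suc digit_prefix_Suc_div[OF assms] by simp
qed simp

lemma digit_prefix_less:
  assumes "k > 0" "0 \<le> x" "x < 1"
  shows "digit_prefix k i x < k ^ i"
proof -
  have "x * real k ^ i < real k ^ i" using assms by simp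
  then have "\<lfloor>x * real k ^ i\<rfloor> < int (k ^ i)" by (simp add: floor_less_iff)
  then show ?thesis unfolding digit_prefix_def using assms by (simp add: nat_less_iff)
qed

text \<open>
  The numbers in \<open>[0,1)\<close> with a prescribed prefix form a half-open interval of length \<open>1 / k\<^sup>i\<close>.
\<close>

lemma measure_digit_prefix:
  assumes "k > 0"
  shows "measure lborel {x\<in>{0..<1}. P (digit_prefix k i x)}
    = real (card {a. a < k ^ i \<and> P a}) / real k ^ i"
proof -
  define I where "I a = {real a / real k ^ i ..< (real a + 1) / real k ^ i}" for a
  have ki: "real k ^ i > 0" using assms by simp
  have mem_I: "x \<in> I a \<longleftrightarrow> digit_prefix k i x = a" if "x \<ge> 0" for x a
  proof -
    have "x \<in> I a \<longleftrightarrow> real a \<le> x * real k ^ i \<and> x * real k ^ i < real a + 1"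
      using ki by (simp add: I_def pos_divide_le_eq pos_less_divide_eq)
    also have "\<dots> \<longleftrightarrow> \<lfloor>x * real k ^ i\<rfloor> = int a" by (auto simp: floor_eq_iff)
    also have "\<dots> \<longleftrightarrow> digit_prefix k i x = a"
    proof -
      have "0 \<le> \<lfloor>x * real k ^ i\<rfloor>" using that by simp
      then show ?thesis unfolding digit_prefix_def by linarith
    qed
    finally show ?thesis .
  qed
  have nonneg: "x \<ge> 0" if "x \<in> I a" for x a
  proof -
    have "0 \<le> real a / real k ^ i" by simp
    then show ?thesis using that unfolding I_def atLeastLessThan_iff by linarith
  qed
  have less1: "x < 1" if "x \<in> I a" "a < k ^ i" for x a
  proof -
    have "real (Suc a) \<le> real (k ^ i)" using that(2) by (simp only: of_nat_le_iff Suc_le_eq)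
    then have "(real a + 1) / real k ^ i \<le> 1" using ki by simp
    then show ?thesis using that(1) by (auto simp: I_def)
  qed
  have "{x\<in>{0..<1}. P (digit_prefix k i x)} = (\<Union>a\<in>{a. a < k ^ i \<and> P a}. I a)"
    (is "?L = ?R")
  proof
    show "?L \<subseteq> ?R" using mem_I digit_prefix_less[OF assms] by auto
    show "?R \<subseteq> ?L"
    proof
      fix x assume "x \<in> ?R"
      then obtain a where "a < k ^ i" "P a" "x \<in> I a" by blast
      then show "x \<in> ?L"
        using mem_I[OF nonneg[OF \<open>x \<in> I a\<close>], of a] nonneg[of x a] less1[of x a] by simp
    qed
  qed
  also have "measure lborel \<dots> = (\<Sum>a\<in>{a. a < k ^ i \<and> P a}. measure lborel (I a))"
  proof (rule measure_finite_Union)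
    show "disjoint_family_on I {a. a < k ^ i \<and> P a}"
      unfolding disjoint_family_on_def
    proof (intro ballI impI equals0I)
      fix a b x assume "a \<noteq> b" "x \<in> I a \<inter> I b"
      then show False using mem_I[OF nonneg[of x a], of a] mem_I[OF nonneg[of x a], of b] by simp
    qed
    show "emeasure lborel (I a) \<noteq> \<infinity>" for a
      using emeasure_bounded_finite[of "I a"] by (simp add: I_def less_top)
  qed (auto simp: I_def)
  also have "\<dots> = (\<Sum>a\<in>{a. a < k ^ i \<and> P a}. 1 / real k ^ i)"
  proof (intro sum.cong refl)
    fix a
    have "real a / real k ^ i \<le> (real a + 1) / real k ^ i" using ki by (simp add: divide_right_mono)
    then show "measure lborel (I a) = 1 / real k ^ i"
      unfolding I_def by (simp add: add_divide_distrib)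
  qed
  finally show ?thesis by simp
qed

text \<open>
  A prefix of length \<open>L\<close> has exactly one extension by a digit that brings the sum to the residue
  \<open>j\<close>, because a residue class modulo \<open>k\<close> contains exactly one digit.
\<close>

lemma card_last_digit_constraint:
  fixes h :: "nat \<Rightarrow> nat"
  assumes "j < k"
  shows "card {b. b < k ^ Suc L \<and> P (b div k) \<and> [h (b div k) + b mod k = j] (mod k)}
    = card {a. a < k ^ L \<and> P a}"
proof (rule bij_betw_same_card[of "\<lambda>b. b div k"], unfold bij_betw_def, intro conjI)
  let ?B = "{b. b < k ^ Suc L \<and> P (b div k) \<and> [h (b div k) + b mod k = j] (mod k)}"
  show "inj_on (\<lambda>b. b div k) ?B"
  proof (rule inj_onI)
    fix b c assume "b \<in> ?B" "c \<in> ?B" and eq: "b div k = c div k"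
    then have "[h (b div k) + b mod k = h (b div k) + c mod k] (mod k)"
      by (auto intro: cong_trans cong_sym)
    then have "[b mod k = c mod k] (mod k)" by (simp only: cong_add_lcancel_nat)
    then have "b mod k = c mod k" by (simp add: cong_def)
    with eq show "b = c" by (metis div_mult_mod_eq)
  qed
  show "(\<lambda>b. b div k) ` ?B = {a. a < k ^ L \<and> P a}"
  proof
    show "(\<lambda>b. b div k) ` ?B \<subseteq> {a. a < k ^ L \<and> P a}"
      using assms by (auto simp: less_mult_imp_div_less mult.commute)
    show "{a. a < k ^ L \<and> P a} \<subseteq> (\<lambda>b. b div k) ` ?B"
    proof
      fix a assume "a \<in> {a. a < k ^ L \<and> P a}"
      then have a: "a < k ^ L" "P a" by auto
      \<comment> \<open>\<open>(k - 1) * h a\<close> plays the role of \<open>- h a\<close> modulo \<open>k\<close>.\<close>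
      define r where "r = (j + (k - 1) * h a) mod k"
      have r: "r < k" using assms by (simp add: r_def)
      have "[h a + r = h a + (j + (k - 1) * h a)] (mod k)"
        unfolding r_def by (simp add: cong_def mod_add_right_eq)
      also have "h a + (j + (k - 1) * h a) = j + k * h a"
        using assms by (cases k) auto
      also have "[\<dots> = j] (mod k)" by (simp add: cong_def)
      finally have "[h a + r = j] (mod k)" .
      moreover have "a * k + r < k ^ Suc L"
      proof -
        have "a * k + r < (a + 1) * k" using r by simp
        also have "\<dots> \<le> k ^ L * k" using a(1) by (intro mult_right_mono) auto
        finally show ?thesis by (simp add: mult.commute)
      qed
      ultimately have "a * k + r \<in> ?B" using a r by simp
      moreover have "a = (a * k + r) div k" using r by simp
      ultimately show "a \<in> (\<lambda>b. b div k) ` ?B" by (rule rev_image_eqI)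
    qed
  qed
qed

text \<open>
  This is the independence statement behind the theorem: fixing the residue of a sum whose last
  summand is a fresh digit has probability \<open>1/k\<close>, conditionally on any event \<open>P\<close> about the
  preceding digits. The term \<open>h\<close> may depend on these digits arbitrarily.
\<close>

lemma measure_last_digit_constraint:
  fixes h :: "nat \<Rightarrow> nat"
  assumes "j < k"
  shows "measure lborel {x\<in>{0..<1}. P (digit_prefix k L x) \<and>
       [h (digit_prefix k L x) + digit_prefix k (Suc L) x mod k = j] (mod k)}
    = measure lborel {x\<in>{0..<1}. P (digit_prefix k L x)} / real k"
proof -
  have k: "k > 0" using assms by simp
  have "measure lborel {x\<in>{0..<1}. P (digit_prefix k L x) \<and>
       [h (digit_prefix k L x) + digit_prefix k (Suc L) x mod k = j] (mod k)}
     = real (card {b. b < k ^ Suc L \<and> P (b div k) \<and> [h (b div k) + b mod k = j] (mod k)})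
         / real k ^ Suc L"
    using measure_digit_prefix[OF k, of "\<lambda>b. P (b div k) \<and> [h (b div k) + b mod k = j] (mod k)" "Suc L"]
    by (simp only: digit_prefix_Suc_div[OF k])
  also have "\<dots> = measure lborel {x\<in>{0..<1}. P (digit_prefix k L x)} / real k"
    unfolding card_last_digit_constraint[OF assms] measure_digit_prefix[OF k]
    by simp
  finally show ?thesis .
qed

section \<open>Equidistribution of the binomial digit sums\<close>

text \<open>
  The half-open unit interval has Lebesgue measure one and all its points have prefixes below
  \<open>k ^ i\<close>, so it serves as the probability space.
\<close>

lemma binomial_digit_sum_frequency_AE:
  fixes N k j :: nat
  assumes "N \<ge> 1" "j < k"
  defines "S \<equiv> \<lambda>n x. \<Sum>l=0..n * N. ((n * N) choose l) * (digit_prefix k (l + 1) x mod k)"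
  shows "AE x in lebesgue. x \<in> {0..<1} \<longrightarrow>
    (\<lambda>p. 1 / real p * real (card {n. 1 \<le> n \<and> n \<le> p \<and> [S n x = j] (mod k)})) \<longlonglongrightarrow> 1 / real k"
proof -
  let ?M = "restrict_space lborel {0..<1::real}"
  have k: "k > 0" using assms by simp
  \<comment> \<open>\<open>h n\<close> recovers all terms of \<open>S n\<close> but the last from the first \<open>n * N\<close> digits.\<close>
  define h where "h n a = (\<Sum>l<n * N. ((n * N) choose l) * (a div k ^ (n * N - (l + 1)) mod k))" for n a
  have S_eq: "S n x = h n (digit_prefix k (n * N) x) + digit_prefix k (Suc (n * N)) x mod k" for n x
  proof -
    have "digit_prefix k (n * N) x div k ^ (n * N - (l + 1)) = digit_prefix k (l + 1) x"
      if "l < n * N" for l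
      using digit_prefix_add_div[OF k, of "l + 1" "n * N - (l + 1)" x] that
      by (simp del: add_Suc)
    then have "h n (digit_prefix k (n * N) x)
        = (\<Sum>l<n * N. ((n * N) choose l) * (digit_prefix k (l + 1) x mod k))"
      unfolding h_def by (intro sum.cong) auto
    then show ?thesis
      unfolding S_def by (simp add: atLeast0AtMost flip: lessThan_Suc_atMost)
  qed
  \<comment> \<open>The index is shifted because the frequency counts \<open>n \<ge> 1\<close>.\<close>
  define A where "A n = {x\<in>{0..<1}. [S (Suc n) x = j] (mod k)}" for n
  have A_sets[measurable]: "A n \<in> sets lborel" for n
    unfolding A_def S_def cong_def by measurable
  have A_measure: "measure lborel (A n) = 1 / real k" for n
  proof -
    have "{x\<in>{0..<1::real}. True} = {0..<1}" by auto
    then have "measure lborel {x\<in>{0..<1::real}. True} = 1" by (simp only:) simp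
    then show ?thesis
      using measure_last_digit_constraint[OF assms(2), of "\<lambda>_. True" "Suc n * N" "h (Suc n)"]
      unfolding A_def S_eq by (simp only: simp_thms)
  qed
  have A_pair: "measure lborel (A m \<inter> A n) = 1 / real k * (1 / real k)" if "m < n" for m n
  proof -
    \<comment> \<open>The fresh digit of the later sum comes after every digit that the earlier sum reads.\<close>
    have le: "Suc (Suc m * N) \<le> Suc n * N"
    proof -
      have "Suc m * N + N \<le> Suc n * N" using mult_le_mono1[of "Suc (Suc m)" "Suc n" N] that by simp
      then show ?thesis using assms(1) by linarith
    qed
    define e where "e = Suc n * N - Suc (Suc m * N)"
    define P where "P a \<longleftrightarrow> [h (Suc m) (a div k ^ e div k) + a div k ^ e mod k = j] (mod k)" for a
    have "digit_prefix k (Suc n * N) x div k ^ e = digit_prefix k (Suc (Suc m * N)) x" for x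
      using digit_prefix_add_div[OF k, of "Suc (Suc m * N)" e x] unfolding e_def le_add_diff_inverse[OF le] .
    then have P_iff: "P (digit_prefix k (Suc n * N) x) \<longleftrightarrow> [S (Suc m) x = j] (mod k)" for x
      unfolding P_def S_eq by (simp only: digit_prefix_Suc_div[OF k])
    have "A m \<inter> A n = {x\<in>{0..<1}. P (digit_prefix k (Suc n * N) x) \<and>
        [h (Suc n) (digit_prefix k (Suc n * N) x) + digit_prefix k (Suc (Suc n * N)) x mod k = j] (mod k)}"
      unfolding A_def P_iff S_eq[symmetric] by auto
    then have "measure lborel (A m \<inter> A n) = measure lborel {x\<in>{0..<1}. P (digit_prefix k (Suc n * N) x)} / real k"
      by (simp only: measure_last_digit_constraint[OF assms(2)])
    also have "{x\<in>{0..<1}. P (digit_prefix k (Suc n * N) x)} = A m"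
      unfolding P_iff A_def ..
    finally show ?thesis using A_measure by simp
  qed
  have A_sub: "A n \<subseteq> {0..<1}" for n by (auto simp: A_def)
  have M_eq: "measure ?M B = measure lborel B" if "B \<subseteq> {0..<1}" for B
    using that by (intro measure_restrict_space) auto
  have M_sets: "B \<in> sets ?M" if "B \<subseteq> {0..<1}" "B \<in> sets lborel" for B
    using that by (auto simp: sets_restrict_space_iff)
  have space_M: "space ?M = {0..<1}" by (simp add: space_restrict_space)
  have M_total: "measure ?M {0..<1} = 1" by (simp add: M_eq)
  interpret M: finite_measure ?M
    by (intro finite_measureI) (simp add: emeasure_restrict_space)
  define f where "f n x = indicator (A n) x - 1 / real k" for n x
  have "AE x in ?M. (\<lambda>p. (\<Sum>n<p. f n x) / real p) \<longlonglongrightarrow> 0"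
  proof (rule orthogonal_averages_tendsto_zero_AE)
    show "finite_measure ?M" by unfold_locales
    show "measure ?M (space ?M) \<le> 1" using M_total space_M by simp
    show "f n \<in> borel_measurable ?M" for n
      unfolding f_def by (intro borel_measurable_diff borel_measurable_indicator borel_measurable_const
        M_sets A_sub A_sets)
    show "\<bar>f n x\<bar> \<le> 1" for n x
      using k by (auto simp: f_def indicator_def)
    fix m n :: nat assume mn: "m < n"
    have ind: "integrable ?M (indicator B :: real \<Rightarrow> real)"
      if "B \<subseteq> {0..<1}" "B \<in> sets lborel" for B
      using M_sets[OF that] by (intro integrable_real_indicator) (simp_all add: less_top[symmetric])
    have ind': "(\<integral>x. indicator B x \<partial>?M) = measure lborel B" if "B \<subseteq> {0..<1}" for B
    proof -
      have "B \<inter> {0..<1} = B" using that by blast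
      then show ?thesis using M_eq[OF that] by (simp add: space_M)
    qed
    have I: "integrable ?M (indicator (A m \<inter> A n) :: real \<Rightarrow> real)"
      using A_sub by (intro ind) auto
    have "(\<integral>x. f m x * f n x \<partial>?M) = (\<integral>x. indicator (A m \<inter> A n) x - 1 / real k * indicator (A m) x
        - 1 / real k * indicator (A n) x + 1 / real k * (1 / real k) \<partial>?M)"
      unfolding f_def by (intro Bochner_Integration.integral_cong refl)
        (auto simp: indicator_inter_arith algebra_simps)
    also have "\<dots> = measure lborel (A m \<inter> A n) - 1 / real k * measure lborel (A m)
        - 1 / real k * measure lborel (A n) + 1 / real k * (1 / real k)"
    proof -
      have "A m \<inter> A n \<subseteq> {0..<1}" using A_sub by blast
      note ind'[OF this] ind'[OF A_sub]
      moreover have "(\<integral>x. 1 / real k * (1 / real k) \<partial>?M) = 1 / real k * (1 / real k)"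
        using M_total by (simp add: space_M)
      ultimately show ?thesis
        using I ind[OF A_sub A_sets]
        by (simp only: Bochner_Integration.integral_add Bochner_Integration.integral_diff
            integral_mult_right_zero Bochner_Integration.integrable_diff
            integrable_mult_right M.integrable_const)
    qed
    also have "\<dots> = 0" using mn by (simp add: A_pair A_measure)
    finally show "(\<integral>x. f m x * f n x \<partial>?M) = 0" .
  qed
  then have "AE x in lborel. x \<in> {0..<1} \<longrightarrow> (\<lambda>p. (\<Sum>n<p. f n x) / real p) \<longlonglongrightarrow> 0"
    by (subst (asm) AE_restrict_space_iff) auto
  then have "AE x in lebesgue. x \<in> {0..<1} \<longrightarrow> (\<lambda>p. (\<Sum>n<p. f n x) / real p) \<longlonglongrightarrow> 0"
    by (rule AE_completion)
  then show ?thesis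
  proof eventually_elim
    case (elim x)
    show ?case
    proof
      assume x: "x \<in> {0..<1}"
      have "(\<lambda>p. (\<Sum>n<p. f n x) / real p + 1 / real k) \<longlonglongrightarrow> 0 + 1 / real k"
        using elim x by (intro tendsto_intros) auto
      moreover have "1 / real p * real (card {n. 1 \<le> n \<and> n \<le> p \<and> [S n x = j] (mod k)})
          = (\<Sum>n<p. f n x) / real p + 1 / real k" if "p \<ge> 1" for p
      proof -
        have "{n. 1 \<le> n \<and> n \<le> p \<and> [S n x = j] (mod k)} = Suc ` {n\<in>{..<p}. x \<in> A n}"
        proof -
          have "n \<in> Suc ` {n\<in>{..<p}. x \<in> A n}" if "1 \<le> n" "n \<le> p" "[S n x = j] (mod k)" for n
            using that x by (cases n) (auto simp: A_def)
          then show ?thesis using x by (auto simp: A_def)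
        qed
        then have "card {n. 1 \<le> n \<and> n \<le> p \<and> [S n x = j] (mod k)} = card {n\<in>{..<p}. x \<in> A n}"
          by (simp add: card_image)
        also have "real \<dots> = (\<Sum>n<p. indicator (A n) x)"
          by (simp add: indicator_def sum.If_cases Int_def)
        also have "\<dots> = (\<Sum>n<p. f n x) + real p / real k"
          by (simp add: f_def sum_subtractf)
        finally show ?thesis using that by (simp add: add_divide_distrib)
      qed
      ultimately show "(\<lambda>p. 1 / real p * real (card {n. 1 \<le> n \<and> n \<le> p \<and> [S n x = j] (mod k)}))
          \<longlonglongrightarrow> 1 / real k"
        by (subst tendsto_cong[where g = "\<lambda>p. (\<Sum>n<p. f n x) / real p + 1 / real k"])
          (auto intro!: eventually_sequentiallyI[of 1])
    qed
  qed
qed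

section \<open>Uniqueness of the development\<close>

text \<open>
  The partial sum \<open>U n\<close> of a development is \<open>V n / k\<^sup>n\<close>, where \<open>V n\<close> has the first \<open>n\<close> digits as
  its base-\<open>k\<close> digits, and the tail lies in \<open>[0, 1 / k\<^sup>n]\<close>. The tail reaches its maximum only
  when all remaining digits are \<open>k - 1\<close>, and then \<open>x\<close> is a \<open>k\<close>-adic rational. Otherwise \<open>V n\<close> is the
  integer part of \<open>x k\<^sup>n\<close>, and its units digit is the digit in question.
\<close>

lemma kadic_development_digit_unique:
  assumes dev: "kadic_development k x d"
    and irr: "\<And>a n. x \<noteq> real a / real k ^ n"
  shows "d (Suc n) = digit_prefix k (Suc n) x mod k"
proof -
  have dk: "d (Suc i) < k" for i using dev by (simp add: kadic_development_def)
  have k: "k > 0" using dk[of 0] by simp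
  define U where "U n = (\<Sum>i<n. real (d (Suc i)) / real k ^ Suc i)" for n
  have U_lim: "U \<longlonglongrightarrow> x"
    using dev unfolding kadic_development_def sums_def U_def by simp
  have lower: "U n \<le> x" for n
    by (rule incseq_le[OF _ U_lim]) (auto simp: U_def intro!: incseq_SucI)
  have upper: "x \<le> U n + 1 / real k ^ n" for n
  proof -
    \<comment> \<open>Partial sum plus the largest possible tail: it decreases as digits become known.\<close>
    define T where "T m = U (m + n) + 1 / real k ^ (m + n)" for m
    have "T (Suc m) \<le> T m" for m
    proof -
      have "real (d (Suc (m + n))) + 1 \<le> real k" using dk[of "m + n"] by linarith
      then have "(real (d (Suc (m + n))) + 1) / real k ^ Suc (m + n) \<le> real k / real k ^ Suc (m + n)"
        by (intro divide_right_mono) auto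
      also have "\<dots> = 1 / real k ^ (m + n)" using k by simp
      finally show ?thesis by (simp add: T_def U_def add_divide_distrib)
    qed
    then have "decseq T" by (rule decseq_SucI)
    moreover have "(\<lambda>m. U (m + n)) \<longlonglongrightarrow> x" using U_lim by (rule LIMSEQ_ignore_initial_segment)
    moreover have "U (m + n) \<le> T 0" for m
      using \<open>decseq T\<close> by (rule order_trans[rotated, OF decseqD[of T 0 m]]) (auto simp: T_def)
    ultimately have "x \<le> T 0" by (intro LIMSEQ_le_const2) auto
    then show ?thesis by (simp add: T_def)
  qed
  define V where "V n = (\<Sum>i<n. d (Suc i) * k ^ (n - Suc i))" for n
  have V_Suc: "V (Suc n) = k * V n + d (Suc n)" for n
  proof -
    have "(\<Sum>i<n. d (Suc i) * k ^ (n - i)) = (\<Sum>i<n. k * (d (Suc i) * k ^ (n - Suc i)))"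
      by (intro sum.cong refl) (simp add: Suc_diff_Suc flip: power_Suc)
    then show ?thesis by (simp add: V_def sum_distrib_left)
  qed
  have U_V: "U n = real (V n) / real k ^ n" for n
  proof (induction n)
    case (Suc n)
    have "U (Suc n) = real (V n) / real k ^ n + real (d (Suc n)) / real k ^ Suc n"
      using Suc by (simp add: U_def)
    then show ?case using k by (simp add: V_Suc add_divide_distrib)
  qed (simp add: U_def V_def)
  have "digit_prefix k (Suc n) x = V (Suc n)"
  proof -
    have kn: "real k ^ Suc n > 0" using k by simp
    have "x \<noteq> (real (V (Suc n)) + 1) / real k ^ Suc n"
      using irr[of "V (Suc n) + 1" "Suc n"] by (simp add: add.commute)
    then have "x < (real (V (Suc n)) + 1) / real k ^ Suc n"
      using upper[of "Suc n"] by (simp add: U_V add_divide_distrib)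
    moreover have "real (V (Suc n)) / real k ^ Suc n \<le> x" using lower[of "Suc n"] by (simp add: U_V)
    ultimately have "\<lfloor>x * real k ^ Suc n\<rfloor> = int (V (Suc n))"
      using kn by (intro floor_unique) (simp_all add: pos_divide_le_eq pos_less_divide_eq)
    then show ?thesis unfolding digit_prefix_def by simp
  qed
  then show ?thesis using dk[of n] by (simp add: V_Suc)
qed

lemma AE_not_kadic_rational:
  "AE x in lebesgue. \<forall>a n. x \<noteq> real a / real k ^ n"
proof -
  have "countable ((\<lambda>(a, n). real a / real k ^ n) ` (UNIV :: (nat \<times> nat) set))"
    by simp
  then have "(\<lambda>(a, n). real a / real k ^ n) ` (UNIV :: (nat \<times> nat) set) \<in> null_sets lebesgue"
    by (metis countable_imp_null_set_lborel null_sets_completionI)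
  then show ?thesis by (rule AE_I') auto
qed

theorem theorem5p3:
  fixes N k j :: nat
  assumes "N \<ge> 1" and "j \<in> {0..<k}"
  shows "AE x in lebesgue_on {0..1::real}. x \<in> {0<..<1} \<longrightarrow>
    (\<forall>d. kadic_development k x d \<longrightarrow>
      (\<lambda>p. 1 / real p *
         real (card {n. 1 \<le> n \<and> n \<le> p \<and>
           [(\<Sum>l=0..n * N. ((n * N) choose l) * d (l + 1)) = j] (mod k)}))
      \<longlonglongrightarrow> 1 / real k)"
proof -
  have "j < k" using assms(2) by simp
  have "AE x in lebesgue. x \<in> {0..1} \<longrightarrow> x \<in> {0<..<1} \<longrightarrow>
    (\<forall>d. kadic_development k x d \<longrightarrow>
      (\<lambda>p. 1 / real p *
         real (card {n. 1 \<le> n \<and> n \<le> p \<and>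
           [(\<Sum>l=0..n * N. ((n * N) choose l) * d (l + 1)) = j] (mod k)}))
      \<longlonglongrightarrow> 1 / real k)"
    using binomial_digit_sum_frequency_AE[OF assms(1) \<open>j < k\<close>] AE_not_kadic_rational[of k]
  proof eventually_elim
    case (elim x)
    show ?case
    proof (intro impI allI)
      fix d assume x: "x \<in> {0<..<1}" and dev: "kadic_development k x d"
      have "d (l + 1) = digit_prefix k (l + 1) x mod k" for l
        using kadic_development_digit_unique[OF dev, of l] elim(2) by simp
      then show "(\<lambda>p. 1 / real p *
         real (card {n. 1 \<le> n \<and> n \<le> p \<and>
           [(\<Sum>l=0..n * N. ((n * N) choose l) * d (l + 1)) = j] (mod k)})) \<longlonglongrightarrow> 1 / real k"
        using elim(1) x by simp
    qed
  qed
  then show ?thesis by (subst AE_restrict_space_iff) auto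
qed

end
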